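(* Let $\mathbb{B}_0=(X_1,X_2,X_3)$ be the basis of the Lie algebra $\mathfrak{sol}$ of $\mathrm{Sol}$ with $[X_1,X_2]=X_2$, $[X_1,X_3]=-X_3$, $[X_2,X_3]=0$. Let $\lambda\neq0$ be real and consider the left invariant metric on $\mathrm{Sol}$ with matrix in $\mathbb{B}_0$ $$\begin{pmatrix}\lambda^2&0&0\\0&\lambda&1\\0&1&0\end{pmatrix}.$$ Its Ricci curvature and scalar curvature are $$M(\mathrm{ric},\mathbb{B}_0)=\begin{pmatrix}0&0&0\\0&-\frac2\lambda&0\\0&0&0\end{pmatrix},\qquad\mathfrak{s}=0,$$ and the Ricci operator satisfies $\mathrm{Ric}^2=0$.
   Context: $\mathrm{Sol}$ is the simply connected Lie group with Lie algebra $\mathfrak{sol}$. A left invariant metric on a Lie group with Lie algebra $\mathfrak{g}$ is identified with a nondegenerate symmetric bilinear form $\langle\,,\rangle$ on $\mathfrak{g}$. The Levi-Civita product $\mathrm{L}:\mathfrak{g}\times\mathfrak{g}\to\mathfrak{g}$ is given by $2\langle\mathrm{L}_uv,w\rangle=\langle[u,v],w\rangle+\langle[w,u],v\rangle+\langle[w,v],u\rangle$, the curvature by $\mathrm{K}(u,v)=\mathrm{L}_{[u,v]}-[\mathrm{L}_u,\mathrm{L}_v]$, the Ricci tensor by $\mathrm{ric}(u,v)=\mathrm{tr}(w\mapsto\mathrm{K}(u,w)v)$, the Ricci operator by $\langle\mathrm{Ric}(u),v\rangle=\mathrm{ric}(u,v)$, and the scalar curvature by $\mathfrak{s}=\mathrm{tr}(\mathrm{Ric})$.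 $M(\mathrm{ric},\mathbb{B}_0)$ is the Gram matrix of $\mathrm{ric}$ in $\mathbb{B}_0$. *)

theory Defs
  imports "HOL-Analysis.Analysis"
begin

text \<open>
  A real Lie algebra of dimension \<open>CARD('n)\<close> is a Lie bracket on the vector space
  \<^typ>\<open>real ^ 'n\<close>, and a left invariant metric on the corresponding Lie group is a
  nondegenerate symmetric bilinear form on it, of arbitrary signature. The standard inner
  product and the standard basis of \<^typ>\<open>real ^ 'n\<close> play no role: bracket, metric and
  ordered basis are arbitrary.
\<close>

definition lie_bracket :: "('a::real_vector \<Rightarrow> 'a \<Rightarrow> 'a) \<Rightarrow> bool" where
  "lie_bracket br \<longleftrightarrow>
     bilinear br \<and> (\<forall>x. br x x = 0) \<and>
     (\<forall>x y z. br x (br y z) + br y (br z x) + br z (br x y) = 0)"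

definition left_invariant_metric :: "('a::real_vector \<Rightarrow> 'a \<Rightarrow> real) \<Rightarrow> bool" where
  "left_invariant_metric g \<longleftrightarrow>
     bilinear g \<and> (\<forall>u v. g u v = g v u) \<and> (\<forall>u. (\<forall>v. g u v = 0) \<longrightarrow> u = 0)"

text \<open>An ordered basis is the vector of its members.\<close>

definition ordered_basis :: "(real ^ 'n) ^ 'n \<Rightarrow> bool" where
  "ordered_basis B \<longleftrightarrow>
     inj (\<lambda>i. B $ i) \<and> independent (range (\<lambda>i. B $ i)) \<and> span (range (\<lambda>i. B $ i)) = UNIV"

definition gram_matrix :: "('a \<Rightarrow> 'a \<Rightarrow> real) \<Rightarrow> 'a ^ 'n \<Rightarrow> real ^ 'n ^ 'n" where
  "gram_matrix b B = (\<chi> i j. b (B $ i) (B $ j))"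

text \<open>
  The trace of an endomorphism is read off its matrix in the standard basis; like any trace,
  it does not depend on the basis.
\<close>

definition endo_trace :: "(real ^ 'n \<Rightarrow> real ^ 'n) \<Rightarrow> real" where
  "endo_trace f = trace (matrix f)"

text \<open>
  The metric determines the vectors below by their pairings with all vectors; existence and
  uniqueness are \<open>metric_representation\<close> and \<open>levi_civita_characterization\<close>.
\<close>

definition levi_civita ::
  "('a::real_vector \<Rightarrow> 'a \<Rightarrow> 'a) \<Rightarrow> ('a \<Rightarrow> 'a \<Rightarrow> real) \<Rightarrow> 'a \<Rightarrow> 'a \<Rightarrow> 'a" where
  "levi_civita br g u v =
     (THE z. \<forall>w. 2 * g z w = g (br u v) w + g (br w u) v + g (br w v) u)"

definition curvature ::
  "('a::real_vector \<Rightarrow> 'a \<Rightarrow> 'a) \<Rightarrow> ('a \<Rightarrow> 'a \<Rightarrow> real) \<Rightarrow> 'a \<Rightarrow> 'a \<Rightarrow> 'a \<Rightarrow> 'a" where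
  "curvature br g u v w =
     levi_civita br g (br u v) w
     - (levi_civita br g u (levi_civita br g v w) - levi_civita br g v (levi_civita br g u w))"

definition ricci ::
  "(real ^ 'n \<Rightarrow> real ^ 'n \<Rightarrow> real ^ 'n) \<Rightarrow> (real ^ 'n \<Rightarrow> real ^ 'n \<Rightarrow> real)
     \<Rightarrow> real ^ 'n \<Rightarrow> real ^ 'n \<Rightarrow> real" where
  "ricci br g u v = endo_trace (\<lambda>w. curvature br g u w v)"

definition ricci_operator ::
  "(real ^ 'n \<Rightarrow> real ^ 'n \<Rightarrow> real ^ 'n) \<Rightarrow> (real ^ 'n \<Rightarrow> real ^ 'n \<Rightarrow> real)
     \<Rightarrow> real ^ 'n \<Rightarrow> real ^ 'n" where
  "ricci_operator br g u = (THE z. \<forall>v. g z v = ricci br g u v)"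

definition scalar_curvature ::
  "(real ^ 'n \<Rightarrow> real ^ 'n \<Rightarrow> real ^ 'n) \<Rightarrow> (real ^ 'n \<Rightarrow> real ^ 'n \<Rightarrow> real) \<Rightarrow> real" where
  "scalar_curvature br g = endo_trace (ricci_operator br g)"

lemma metric_representation:
  fixes g :: "real ^ 'n \<Rightarrow> real ^ 'n \<Rightarrow> real"
  assumes g: "left_invariant_metric g" and \<phi>: "linear \<phi>"
  shows "\<exists>!z. \<forall>v. g z v = \<phi> v"
proof -
  have bil: "bilinear g" and nd: "\<And>u. (\<forall>v. g u v = 0) \<Longrightarrow> u = 0"
    using g unfolding left_invariant_metric_def by auto
  have linr: "linear (g z)" for z
    using bil unfolding bilinear_def by auto
  have eqI: "g z v = h v" if "\<And>i. g z (axis i 1) = h (axis i 1)" "linear h" for z h v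
    using linear_eq_stdbasis[OF linr that(2), of z] that(1)
    by (auto simp: Basis_vec_def)
  let ?F = "\<lambda>z. (\<chi> i. g z (axis i 1)) :: real ^ 'n"
  have lin: "linear ?F"
    by (rule linearI) (simp_all add: vec_eq_iff bilinear_ladd[OF bil] bilinear_lmul[OF bil])
  have "z = 0" if "?F z = 0" for z
  proof -
    have "g z v = (\<lambda>_. 0) v" for v
      by (rule eqI) (use that in \<open>auto simp: vec_eq_iff linear_zero\<close>)
    then show ?thesis using nd by simp
  qed
  then have inj: "inj ?F"
    using linear_injective_0[OF lin] by blast
  then have "surj ?F"
    using linear_injective_imp_surjective[OF lin] by blast
  then obtain z where "(\<chi> i. \<phi> (axis i 1)) = ?F z"
    by (meson surjE)
  then have z: "g z (axis i 1) = \<phi> (axis i 1)" for i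
    by (simp add: vec_eq_iff)
  show ?thesis
  proof (rule ex1I[of _ z])
    show "\<forall>v. g z v = \<phi> v" using eqI[of z \<phi>] z \<phi> by blast
  next
    fix y assume "\<forall>v. g y v = \<phi> v"
    then have "?F y = ?F z" using z by (simp add: vec_eq_iff)
    then show "y = z" by (rule injD[OF inj])
  qed
qed

lemma levi_civita_characterization:
  fixes g :: "real ^ 'n \<Rightarrow> real ^ 'n \<Rightarrow> real"
  assumes br: "lie_bracket br" and g: "left_invariant_metric g"
  shows "2 * g (levi_civita br g u v) w = g (br u v) w + g (br w u) v + g (br w v) u"
proof -
  have bg: "bilinear g" and bb: "bilinear br"
    using assms unfolding left_invariant_metric_def lie_bracket_def by auto
  let ?\<phi> = "\<lambda>w. (g (br u v) w + g (br w u) v + g (br w v) u) / 2"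
  have "linear ?\<phi>"
    by (rule linearI)
       (simp_all add: bilinear_ladd[OF bg] bilinear_radd[OF bg] bilinear_lmul[OF bg]
          bilinear_rmul[OF bg] bilinear_ladd[OF bb] bilinear_lmul[OF bb] field_simps)
  then have "\<exists>!z. \<forall>w. g z w = ?\<phi> w"
    by (rule metric_representation[OF g])
  moreover have "(g z w = ?\<phi> w) \<longleftrightarrow>
      (2 * g z w = g (br u v) w + g (br w u) v + g (br w v) u)" for z w
    by auto
  ultimately have "\<exists>!z. \<forall>w. 2 * g z w = g (br u v) w + g (br w u) v + g (br w v) u"
    by simp
  from theI'[OF this] show ?thesis unfolding levi_civita_def by blast
qed

end

theory Submission
  imports Defs
begin

text \<open>
  All tensors involved are multilinear and traces are invariant under conjugation, so
  everything can be read off on the basis \<open>X\<^sub>1, X\<^sub>2, X\<^sub>3\<close>. There the Ricci operator kills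
  \<open>X\<^sub>1\<close> and \<open>X\<^sub>3\<close> and maps \<open>X\<^sub>2\<close> to \<open>- (2 / \<lambda>) X\<^sub>3\<close>, so its trace
  and its square vanish.
\<close>

text \<open>With the basis vectors as rows, \<open>B\<close> is an invertible matrix, and the
  coordinates of \<open>f (B $ i)\<close> form row \<open>i\<close> of \<open>A\<close>, hence the
  transpose in \<open>B ** transpose (matrix f) = A ** B\<close>. So \<open>A\<close> is conjugate
  to \<open>transpose (matrix f)\<close>, and the trace is invariant under conjugation and
  transposition.\<close>

lemma endo_trace_ordered_basis:
  fixes f :: "real ^ 'n \<Rightarrow> real ^ 'n"
  assumes f: "linear f" and B: "ordered_basis B"
    and A: "\<And>i. f (B $ i) = (\<Sum>j\<in>UNIV. A $ i $ j *\<^sub>R B $ j)"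
  shows "endo_trace f = trace A"
proof -
  have "rows B = range (\<lambda>i. B $ i)"
    by (auto simp: rows_def row_def)
  then have "span (rows B) = UNIV"
    using B by (simp add: ordered_basis_def)
  then obtain C where CB: "C ** B = mat 1"
    using matrix_left_invertible_span_rows by blast
  then have BC: "B ** C = mat 1"
    using matrix_left_right_inverse by blast
  have "(B ** transpose (matrix f)) $ i = f (B $ i)" for i
    using fun_cong[OF matrix_vector_mul(2)[OF f], of "B $ i"]
    by (simp add: vec_eq_iff matrix_matrix_mult_def matrix_vector_mult_def transpose_def mult.commute)
  moreover have "(A ** B) $ i = f (B $ i)" for i
    by (simp add: A vec_eq_iff matrix_matrix_mult_def)
  ultimately have "B ** transpose (matrix f) = A ** B"
    by (simp add: vec_eq_iff)
  then have "transpose (matrix f) = C ** (A ** B)"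
    by (metis CB matrix_mul_assoc matrix_mul_lid)
  \<comment> \<open>Cyclicity moves \<open>C\<close> to the right of \<open>A ** B\<close>, where it
    cancels \<open>B\<close>.\<close>
  then have "trace (transpose (matrix f)) = trace A"
    by (metis BC trace_mul_sym matrix_mul_assoc matrix_mul_rid)
  then show ?thesis
    by (simp add: endo_trace_def trace_def transpose_def)
qed

lemma ordered_basis_vector_3:
  fixes X1 X2 X3 :: "real ^ 3"
  assumes "ordered_basis (vector [X1, X2, X3])"
  shows "span {X1, X2, X3} = UNIV"
proof -
  have "range (\<lambda>i. (vector [X1, X2, X3] :: (real ^ 3) ^ 3) $ i) = {X1, X2, X3}"
    by (simp add: UNIV_3)
  then show ?thesis
    using assms by (simp add: ordered_basis_def)
qed

text \<open>This is the form in which the Ricci tensor and the scalar curvature are computed: row by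
  row, the coordinates of the images of the three basis vectors.\<close>

lemma endo_trace_vector_3:
  fixes X1 X2 X3 :: "real ^ 3"
  assumes "linear f" and "ordered_basis (vector [X1, X2, X3])"
    and "f X1 = a11 *\<^sub>R X1 + a12 *\<^sub>R X2 + a13 *\<^sub>R X3"
    and "f X2 = a21 *\<^sub>R X1 + a22 *\<^sub>R X2 + a23 *\<^sub>R X3"
    and "f X3 = a31 *\<^sub>R X1 + a32 *\<^sub>R X2 + a33 *\<^sub>R X3"
  shows "endo_trace f = a11 + a22 + a33"
proof -
  let ?A = "vector [vector [a11, a12, a13], vector [a21, a22, a23], vector [a31, a32, a33]]
    :: real ^ 3 ^ 3"
  have "\<forall>i. f (vector [X1, X2, X3] $ i) =
      (\<Sum>j\<in>UNIV. ?A $ i $ j *\<^sub>R vector [X1, X2, X3] $ j)"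
    using assms(3-) by (simp add: forall_3 sum_3)
  then have "endo_trace f = trace ?A"
    using endo_trace_ordered_basis[OF assms(1,2)] by blast
  then show ?thesis
    by (simp add: trace_def sum_3)
qed

text \<open>By linearity in the second argument, \<open>a - b\<close> is orthogonal to the whole
  space, so it is zero by nondegeneracy.\<close>

lemma metric_eqI:
  assumes g: "left_invariant_metric g" and S: "span S = UNIV"
    and eq: "\<And>w. w \<in> S \<Longrightarrow> g a w = g b w"
  shows "a = b"
proof -
  have bg: "bilinear g"
    using g by (simp add: left_invariant_metric_def)
  have "g a w = g b w" for w
    using linear_eq_on_span[of "g a" "g b" S w] bg eq S by (auto simp: bilinear_def)
  then have "\<forall>w. g (a - b) w = 0"
    by (simp add: bilinear_lsub[OF bg])
  then have "a - b = 0"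
    using g unfolding left_invariant_metric_def by blast
  then show ?thesis by simp
qed

text \<open>Replaces the definite description by a check of the Koszul formula on a spanning set: on
  the basis for concrete products, on \<open>UNIV\<close> for bilinearity.\<close>

lemma levi_civita_eqI:
  fixes g :: "real ^ 'n \<Rightarrow> real ^ 'n \<Rightarrow> real"
  assumes br: "lie_bracket br" and g: "left_invariant_metric g" and S: "span S = UNIV"
    and eq: "\<And>w. w \<in> S \<Longrightarrow> 2 * g z w = g (br u v) w + g (br w u) v + g (br w v) u"
  shows "levi_civita br g u v = z"
proof (rule metric_eqI[OF g S])
  show "g (levi_civita br g u v) w = g z w" if "w \<in> S" for w
    using eq[OF that] levi_civita_characterization[OF br g, of u v w] by simp
qed

text \<open>The right side of the Koszul formula is linear in \<open>u\<close> and in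
  \<open>v\<close>, and uniqueness carries this over to the product.\<close>

lemma bilinear_levi_civita:
  fixes g :: "real ^ 'n \<Rightarrow> real ^ 'n \<Rightarrow> real"
  assumes br: "lie_bracket br" and g: "left_invariant_metric g"
  shows "bilinear (levi_civita br g)"
proof -
  have bg: "bilinear g" and bb: "bilinear br"
    using assms by (auto simp: left_invariant_metric_def lie_bracket_def)
  note simps = levi_civita_characterization[OF br g]
    bilinear_ladd[OF bg] bilinear_radd[OF bg] bilinear_lmul[OF bg] bilinear_rmul[OF bg]
    bilinear_ladd[OF bb] bilinear_radd[OF bb] bilinear_lmul[OF bb] bilinear_rmul[OF bb]
  note eqI = levi_civita_eqI[OF br g span_UNIV]
  show ?thesis
    unfolding bilinear_def
    by (intro conjI allI linearI eqI)
       \<comment> \<open>The factor 2 is moved inwards to the pairing, where the Koszul formula can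
         rewrite it.\<close>
       (simp_all add: simps distrib_left mult.left_commute[of 2])
qed

text \<open>The second slot is the one over which the Ricci tensor takes a trace; the first and
  third become the two arguments of that tensor.\<close>

lemma
  fixes g :: "real ^ 'n \<Rightarrow> real ^ 'n \<Rightarrow> real"
  assumes br: "lie_bracket br" and g: "left_invariant_metric g"
  shows linear_curvature_1: "linear (\<lambda>u. curvature br g u v w)"
    and linear_curvature_2: "linear (\<lambda>v. curvature br g u v w)"
    and linear_curvature_3: "linear (\<lambda>w. curvature br g u v w)"
proof -
  have bL: "bilinear (levi_civita br g)" and bb: "bilinear br"
    using assms bilinear_levi_civita by (auto simp: lie_bracket_def)
  note simps = bilinear_ladd[OF bL] bilinear_radd[OF bL] bilinear_lmul[OF bL] bilinear_rmul[OF bL]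
    bilinear_ladd[OF bb] bilinear_radd[OF bb] bilinear_lmul[OF bb] bilinear_rmul[OF bb]
  show "linear (\<lambda>u. curvature br g u v w)" "linear (\<lambda>v. curvature br g u v w)"
    "linear (\<lambda>w. curvature br g u v w)"
    by (intro linearI; simp add: curvature_def simps algebra_simps)+
qed

lemma bilinear_ricci:
  fixes g :: "real ^ 'n \<Rightarrow> real ^ 'n \<Rightarrow> real"
  assumes br: "lie_bracket br" and g: "left_invariant_metric g"
  shows "bilinear (ricci br g)"
  using linear_add[OF linear_curvature_1[OF br g]] linear_scale[OF linear_curvature_1[OF br g]]
    linear_add[OF linear_curvature_3[OF br g]] linear_scale[OF linear_curvature_3[OF br g]]
  unfolding bilinear_def ricci_def endo_trace_def trace_def matrix_def
  by (auto intro!: linearI simp: sum.distrib sum_distrib_left)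

text \<open>The Ricci tensor is linear in \<open>v\<close>, so the metric represents it by a unique
  vector.\<close>

lemma metric_ricci_operator:
  fixes g :: "real ^ 'n \<Rightarrow> real ^ 'n \<Rightarrow> real"
  assumes br: "lie_bracket br" and g: "left_invariant_metric g"
  shows "g (ricci_operator br g u) v = ricci br g u v"
proof -
  have "linear (ricci br g u)"
    using bilinear_ricci[OF br g] by (simp add: bilinear_def)
  from theI'[OF metric_representation[OF g this]] show ?thesis
    unfolding ricci_operator_def by blast
qed

lemma linear_ricci_operator:
  fixes g :: "real ^ 'n \<Rightarrow> real ^ 'n \<Rightarrow> real"
  assumes br: "lie_bracket br" and g: "left_invariant_metric g"
  shows "linear (ricci_operator br g)"
proof -
  have bg: "bilinear g"
    using g by (simp add: left_invariant_metric_def)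
  note bR = bilinear_ricci[OF br g]
  show ?thesis
    by (intro linearI metric_eqI[OF g span_UNIV])
       (simp_all add: metric_ricci_operator[OF br g] bilinear_ladd[OF bg] bilinear_lmul[OF bg]
         bilinear_ladd[OF bR] bilinear_lmul[OF bR])
qed

theorem proposition4p15:
  fixes br :: "real ^ 3 \<Rightarrow> real ^ 3 \<Rightarrow> real ^ 3"
    and g :: "real ^ 3 \<Rightarrow> real ^ 3 \<Rightarrow> real"
    and X1 X2 X3 :: "real ^ 3"
    and B0 :: "(real ^ 3) ^ 3"
    and lambda :: real
  assumes "lie_bracket br"
    and "B0 = vector [X1, X2, X3]"
    and "ordered_basis B0"
    and "br X1 X2 = X2" and "br X1 X3 = - X3" and "br X2 X3 = 0"
    and "lambda \<noteq> 0"
    and "left_invariant_metric g"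
    and "gram_matrix g B0 =
           vector [vector [lambda\<^sup>2, 0, 0],
                   vector [0, lambda, 1],
                   vector [0, 1, 0]]"
  shows "gram_matrix (ricci br g) B0 =
           vector [vector [0, 0, 0],
                   vector [0, - (2 / lambda), 0],
                   vector [0, 0, 0]]
         \<and> scalar_curvature br g = 0
         \<and> ricci_operator br g \<circ> ricci_operator br g = (\<lambda>_. 0)"
proof -
  note br = assms(1) and g = assms(8) and lambda = assms(7)
  have basis: "ordered_basis (vector [X1, X2, X3])"
    using assms by simp
  note S = ordered_basis_vector_3[OF basis]
  have bg: "bilinear g" and bb: "bilinear br" and alt: "\<And>x. br x x = 0"
    using br g by (auto simp: left_invariant_metric_def lie_bracket_def)
  have anti: "br y x = - br x y" for x y
    using alt[of "x + y"]
    by (simp add: bilinear_ladd[OF bb] bilinear_radd[OF bb] alt[of x] alt[of y]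
          eq_neg_iff_add_eq_0 add.commute)
  have gX: "g X1 X1 = lambda\<^sup>2" "g X1 X2 = 0" "g X1 X3 = 0" "g X2 X1 = 0" "g X2 X2 = lambda"
    "g X2 X3 = 1" "g X3 X1 = 0" "g X3 X2 = 1" "g X3 X3 = 0"
    using assms(9) unfolding assms(2) gram_matrix_def
    by (simp_all add: vec_eq_iff forall_3)
  have brX: "br X1 X1 = 0" "br X1 X2 = X2" "br X1 X3 = - X3" "br X2 X1 = - X2" "br X2 X2 = 0"
    "br X2 X3 = 0" "br X3 X1 = X3" "br X3 X2 = 0" "br X3 X3 = 0"
    using assms(4-6) anti[of X2 X1] anti[of X3 X1] anti[of X3 X2] by (simp_all add: alt)
  note g_simps = gX bilinear_ladd[OF bg] bilinear_lsub[OF bg] bilinear_lmul[OF bg]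
    bilinear_lneg[OF bg] bilinear_lzero[OF bg]
  let ?L = "levi_civita br g"
  \<comment> \<open>Inverting the Gram matrix, the vector with pairings \<open>a\<close>,
    \<open>b\<close>, \<open>c\<close> against \<open>X1\<close>, \<open>X2\<close>,
    \<open>X3\<close> has coordinates \<open>a / lambda\<^sup>2\<close>, \<open>c\<close>,
    \<open>b - lambda * c\<close>. Half the Koszul right sides, inserted here, give the
    table.\<close>
  have LX: "?L X1 X1 = 0" "?L X1 X2 = X2 - lambda *\<^sub>R X3" "?L X1 X3 = - X3"
    "?L X2 X1 = - (lambda *\<^sub>R X3)" "?L X2 X2 = (1 / lambda) *\<^sub>R X1" "?L X2 X3 = 0"
    "?L X3 X1 = 0" "?L X3 X2 = 0" "?L X3 X3 = 0"
    by (rule levi_civita_eqI[OF br g S];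
        use lambda in \<open>auto simp: g_simps brX power2_eq_square\<close>)+
  have bL: "bilinear ?L"
    by (rule bilinear_levi_civita[OF br g])
  note K_simps = curvature_def brX LX
    bilinear_ladd[OF bL] bilinear_lsub[OF bL] bilinear_lmul[OF bL] bilinear_lneg[OF bL]
    bilinear_lzero[OF bL] bilinear_radd[OF bL] bilinear_rsub[OF bL] bilinear_rmul[OF bL]
    bilinear_rneg[OF bL] bilinear_rzero[OF bL]
  \<comment> \<open>The nine coefficients are the coordinates of
    \<open>curvature br g u X1 v\<close>, then of those with \<open>X2\<close> and \<open>X3\<close>
    in the middle slot.\<close>
  note ric_eqI = endo_trace_vector_3[OF linear_curvature_2[OF br g] basis, folded ricci_def]
  let ?K = "curvature br g"
  have K_anti: "?K v u w = - ?K u v w" for u v w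
    unfolding curvature_def anti[of v u] by (simp add: bilinear_lneg[OF bL])
  have K_alt: "?K u u w = 0" for u w
    by (simp add: K_simps alt)
  \<comment> \<open>Since \<open>[X1, X3]\<close> and \<open>[X2, X3]\<close> are multiples of
    \<open>X3\<close>, every term of \<open>?K X1 X3\<close> and \<open>?K X2 X3\<close> contains
    \<open>?L X3\<close> and vanishes. Up to sign only \<open>?K X1 X2\<close> remains.\<close>
  have L3: "?L X3 v = 0" for v
    using linear_eq_on_span[OF _ linear_zero, of "?L X3" "{X1, X2, X3}" v] S bL
    by (force simp: LX bilinear_def)
  have K12: "?K X1 X2 X1 = (-2 * lambda) *\<^sub>R X3" "?K X1 X2 X2 = (2 / lambda) *\<^sub>R X1"
    "?K X1 X2 X3 = 0"
    by (simp_all add: K_simps vec_eq_iff)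
  have K3: "?K X1 X3 v = 0" "?K X2 X3 v = 0" for v
    by (simp_all add: K_simps L3)
  note KX = K12 K3 K_alt K_anti[of X2 X1] K_anti[of X3 X1] K_anti[of X3 X2]
  \<comment> \<open>In each of the nine traces at most one coefficient is nonzero. It lies on the
    diagonal only for the pair \<open>X2\<close>, \<open>X2\<close>, through
    \<open>?K X2 X1 X2 = - (2 / lambda) *\<^sub>R X1\<close>.\<close>
  have r11: "ricci br g X1 X1 = 0"
    using ric_eqI[of X1 X1 0 0 0 0 0 "-2 * lambda" 0 0 0] by (simp add: KX)
  have r12: "ricci br g X1 X2 = 0"
    using ric_eqI[of X1 X2 0 0 0 "2 / lambda" 0 0 0 0 0] by (simp add: KX)
  have r13: "ricci br g X1 X3 = 0"
    using ric_eqI[of X1 X3 0 0 0 0 0 0 0 0 0] by (simp add: KX)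
  have r21: "ricci br g X2 X1 = 0"
    using ric_eqI[of X2 X1 0 0 "2 * lambda" 0 0 0 0 0 0] by (simp add: KX)
  have r22: "ricci br g X2 X2 = - (2 / lambda)"
    using ric_eqI[of X2 X2 "- (2 / lambda)" 0 0 0 0 0 0 0 0] by (simp add: KX)
  have r23: "ricci br g X2 X3 = 0"
    using ric_eqI[of X2 X3 0 0 0 0 0 0 0 0 0] by (simp add: KX)
  have r31: "ricci br g X3 X1 = 0"
    using ric_eqI[of X3 X1 0 0 0 0 0 0 0 0 0] by (simp add: KX)
  have r32: "ricci br g X3 X2 = 0"
    using ric_eqI[of X3 X2 0 0 0 0 0 0 0 0 0] by (simp add: KX)
  have r33: "ricci br g X3 X3 = 0"
    using ric_eqI[of X3 X3 0 0 0 0 0 0 0 0 0] by (simp add: KX)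
  note ric = r11 r12 r13 r21 r22 r23 r31 r32 r33
  let ?R = "ricci_operator br g"
  note linR = linear_ricci_operator[OF br g]
  \<comment> \<open>The null vector \<open>X3\<close> pairs to 1 with \<open>X2\<close> and to 0
    with \<open>X1\<close> and \<open>X3\<close>, so it represents the only nonzero row of the Ricci
    tensor.\<close>
  have RX: "?R X1 = 0" "?R X2 = - (2 / lambda) *\<^sub>R X3" "?R X3 = 0"
    by (rule metric_eqI[OF g S]; auto simp: metric_ricci_operator[OF br g] ric g_simps)+
  have "gram_matrix (ricci br g) B0 =
      vector [vector [0, 0, 0], vector [0, - (2 / lambda), 0], vector [0, 0, 0]]"
    unfolding assms(2) gram_matrix_def by (simp add: vec_eq_iff forall_3 ric)
  \<comment> \<open>The unevaluated sum fixes the three diagonal coefficients by unification; only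
    the off-diagonal ones are given explicitly.\<close>
  moreover have "scalar_curvature br g = 0 + 0 + 0"
    unfolding scalar_curvature_def
    by (rule endo_trace_vector_3[OF linR basis, of _ 0 0 0 _ "- (2 / lambda)" 0 0])
       (simp_all add: RX)
  moreover have "(?R \<circ> ?R) v = 0" for v
    using linear_eq_on_span[OF linear_compose[OF linR linR] linear_zero, of "{X1, X2, X3}" v] S
    by (force simp: RX linear_scale[OF linR] linear_neg[OF linR] linear_0[OF linR])
  ultimately show ?thesis by auto
qed

end
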